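(* Let $\mathcal{H}$ be a complex Hilbert space, let $T, A, C\in\mathcal{B}(\mathcal{H})$ with $A$ invertible, and suppose that $T$ is similar to $C$ by $A$, i.e. $AT=CA$. Then $T^n$ is similar to $C^n$ by $A$ for every $n\in\mathbb{N}$ (i.e. $AT^n=C^nA$), and $A\mathcal{D}_T=\mathcal{D}_CA$ (equivalently $A\mathcal{D}_TA^{-1}=\mathcal{D}_C$, equivalently $\mathcal{D}_T=A^{-1}\mathcal{D}_CA$). Also $A\mathcal{B}_T=\mathcal{B}_CA$ (equivalently $A\mathcal{B}_TA^{-1}=\mathcal{B}_C$, equivalently $\mathcal{B}_T=A^{-1}\mathcal{B}_CA$).
   Context: $\mathcal{B}(\mathcal{H})$ is the algebra of all bounded linear operators on $\mathcal{H}$. For $T\in\mathcal{B}(\mathcal{H})$ the Deddens algebra $\mathcal{D}_T$ is the set of all $S\in\mathcal{B}(\mathcal{H})$ for which there is $M>0$ with $\|T^nSx\|\le M\|T^nx\|$ for all $n\in\mathbb{N}$ and $x\in\mathcal{H}$. Let $r(T)$ be the spectral radius of $T$; for integers $m\ge1$ put $d_m=\frac{1}{1/m+r(T)}$ and $R_m=R_m(T)=\left(\sum_{n=0}^{\infty}d_m^{2n}T^{*n}T^n\right)^{1/2}$ (the series converges in norm and $R_m$ is positive and invertible). The spectral radius algebra $\mathcal{B}_T$ is the set of all $S\in\mathcal{B}(\mathcal{H})$ with $\sup_{m\in\mathbb{N}}\|R_mSR_m^{-1}\|<\infty$. For a set $\mathcal{E}$ of operators, $A\mathcal{E}=\{AS:S\in\mathcal{E}\}$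 and $\mathcal{E}A=\{SA:S\in\mathcal{E}\}$. *)

theory Defs
  imports "HOL-Analysis.Analysis"
begin

text \<open>
  The scalar product is linear in the first argument. Positive definiteness is part of
  \<open>cinner_self\<close>, since the norm of a \<open>banach\<close> space is definite. The zero space is allowed.
\<close>

class complex_hilbert = banach +
  fixes scaleC :: "complex \<Rightarrow> 'a \<Rightarrow> 'a"  (infixr \<open>*\<^sub>C\<close> 75)
    and cinner :: "'a \<Rightarrow> 'a \<Rightarrow> complex"
  assumes scaleC_add_right: "a *\<^sub>C (x + y) = a *\<^sub>C x + a *\<^sub>C y"
    and scaleC_add_left: "(a + b) *\<^sub>C x = a *\<^sub>C x + b *\<^sub>C x"
    and scaleC_scaleC: "a *\<^sub>C (b *\<^sub>C x) = (a * b) *\<^sub>C x"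
    and scaleC_of_real: "complex_of_real r *\<^sub>C x = r *\<^sub>R x"
    and cinner_add_left: "cinner (x + y) z = cinner x z + cinner y z"
    and cinner_scaleC_left: "cinner (a *\<^sub>C x) y = a * cinner x y"
    and cinner_commute: "cinner x y = cnj (cinner y x)"
    and cinner_self: "cinner x x = complex_of_real ((norm x)\<^sup>2)"

lemma norm_scaleC: "norm (a *\<^sub>C x) = cmod a * norm (x :: 'a::complex_hilbert)"
proof -
  have "complex_of_real ((norm (a *\<^sub>C x))\<^sup>2) = a * cnj a * cinner x x"
    by (metis cinner_commute cinner_scaleC_left cinner_self complex_cnj_mult mult.assoc)
  also have "\<dots> = complex_of_real ((cmod a * norm x)\<^sup>2)"
    by (simp only: cinner_self complex_norm_square[symmetric] of_real_mult[symmetric]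
        power_mult_distrib[symmetric])
  finally show ?thesis
    by (metis of_real_eq_iff norm_ge_zero mult_nonneg_nonneg power2_eq_iff_nonneg)
qed

lemma bounded_linear_scaleC: "bounded_linear (\<lambda>x :: 'a::complex_hilbert. a *\<^sub>C x)"
proof (rule bounded_linear_intro[where K = "cmod a"])
  fix x y :: 'a and r :: real
  show "a *\<^sub>C (x + y) = a *\<^sub>C x + a *\<^sub>C y"
    by (rule scaleC_add_right)
  show "a *\<^sub>C (r *\<^sub>R x) = r *\<^sub>R (a *\<^sub>C x)"
    by (metis scaleC_of_real scaleC_scaleC mult.commute)
  show "norm (a *\<^sub>C x) \<le> norm x * cmod a"
    by (simp add: norm_scaleC)
qed

text \<open>
  Elements of \<^typ>\<open>'a \<Rightarrow>\<^sub>L 'a\<close> are only real linear; the algebra \<open>\<B>(\<H>)\<close> consists of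
  those which are complex linear. The norm on \<^typ>\<open>'a \<Rightarrow>\<^sub>L 'a\<close> is the operator norm.
\<close>

definition bounded_ops :: "('a::complex_hilbert \<Rightarrow>\<^sub>L 'a) set" where
  "bounded_ops = {T :: 'a \<Rightarrow>\<^sub>L 'a. \<forall>a x. T (a *\<^sub>C x) = a *\<^sub>C T x}"

definition op_power :: "('a::complex_hilbert \<Rightarrow>\<^sub>L 'a) \<Rightarrow> nat \<Rightarrow> 'a \<Rightarrow>\<^sub>L 'a" where
  "op_power T n = ((\<lambda>S. T o\<^sub>L S) ^^ n) id_blinfun"

definition is_op_inverse :: "('a::complex_hilbert \<Rightarrow>\<^sub>L 'a) \<Rightarrow> ('a \<Rightarrow>\<^sub>L 'a) \<Rightarrow> bool" where
  "is_op_inverse T S \<longleftrightarrow> S \<in> bounded_ops \<and> S o\<^sub>L T = id_blinfun \<and> T o\<^sub>L S = id_blinfun"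

definition op_invertible :: "('a::complex_hilbert \<Rightarrow>\<^sub>L 'a) \<Rightarrow> bool" where
  "op_invertible T \<longleftrightarrow> (\<exists>S. is_op_inverse T S)"

definition op_inverse :: "('a::complex_hilbert \<Rightarrow>\<^sub>L 'a) \<Rightarrow> 'a \<Rightarrow>\<^sub>L 'a" where
  "op_inverse T = (THE S. is_op_inverse T S)"

text \<open>Adjoint and positive square root are unique where they exist.\<close>

definition op_adjoint :: "('a::complex_hilbert \<Rightarrow>\<^sub>L 'a) \<Rightarrow> 'a \<Rightarrow>\<^sub>L 'a" where
  "op_adjoint T = (SOME S. S \<in> bounded_ops \<and>
     (\<forall>x y. cinner (T x) y = cinner x (S y)))"

definition positive_op :: "('a::complex_hilbert \<Rightarrow>\<^sub>L 'a) \<Rightarrow> bool" where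
  "positive_op T \<longleftrightarrow> T \<in> bounded_ops \<and> (\<forall>x. cinner (T x) x \<in> \<real>\<^sub>\<ge>\<^sub>0)"

definition op_sqrt :: "('a::complex_hilbert \<Rightarrow>\<^sub>L 'a) \<Rightarrow> 'a \<Rightarrow>\<^sub>L 'a" where
  "op_sqrt T = (SOME R. positive_op R \<and> R o\<^sub>L R = T)"

definition op_spectrum :: "('a::complex_hilbert \<Rightarrow>\<^sub>L 'a) \<Rightarrow> complex set" where
  "op_spectrum T = {z. \<not> op_invertible (T - Blinfun (\<lambda>x. z *\<^sub>C x))}"

text \<open>
  Inserting 0 matters only when the spectrum is empty, that is, on the zero space, where
  it gives the radius 0; \<open>Sup {}\<close> is unspecified on the reals.
\<close>

definition op_spectral_radius :: "('a::complex_hilbert \<Rightarrow>\<^sub>L 'a) \<Rightarrow> real" where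
  "op_spectral_radius T = Sup (insert 0 (cmod ` op_spectrum T))"

definition deddens_algebra :: "('a::complex_hilbert \<Rightarrow>\<^sub>L 'a) \<Rightarrow> ('a \<Rightarrow>\<^sub>L 'a) set" where
  "deddens_algebra T = {S \<in> bounded_ops. \<exists>M>0. \<forall>n x.
     norm (op_power T n (S x)) \<le> M * norm (op_power T n x)}"

definition d_coeff :: "('a::complex_hilbert \<Rightarrow>\<^sub>L 'a) \<Rightarrow> nat \<Rightarrow> real" where
  "d_coeff T m = 1 / (1 / real m + op_spectral_radius T)"

definition R_op :: "('a::complex_hilbert \<Rightarrow>\<^sub>L 'a) \<Rightarrow> nat \<Rightarrow> 'a \<Rightarrow>\<^sub>L 'a" where
  "R_op T m = op_sqrt
     (\<Sum>n. d_coeff T m ^ (2 * n) *\<^sub>R (op_power (op_adjoint T) n o\<^sub>L op_power T n))"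

definition spectral_radius_algebra :: "('a::complex_hilbert \<Rightarrow>\<^sub>L 'a) \<Rightarrow> ('a \<Rightarrow>\<^sub>L 'a) set" where
  "spectral_radius_algebra T = {S \<in> bounded_ops.
     bdd_above ((\<lambda>m. norm (R_op T m o\<^sub>L S o\<^sub>L op_inverse (R_op T m))) ` {1..})}"

definition op_left_mult ::
    "('a::complex_hilbert \<Rightarrow>\<^sub>L 'a) \<Rightarrow> ('a \<Rightarrow>\<^sub>L 'a) set \<Rightarrow> ('a \<Rightarrow>\<^sub>L 'a) set" where
  "op_left_mult A E = {A o\<^sub>L S | S. S \<in> E}"

definition op_right_mult ::
    "('a::complex_hilbert \<Rightarrow>\<^sub>L 'a) set \<Rightarrow> ('a \<Rightarrow>\<^sub>L 'a) \<Rightarrow> ('a \<Rightarrow>\<^sub>L 'a) set" where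
  "op_right_mult E A = {S o\<^sub>L A | S. S \<in> E}"

end

theory Submission
  imports Defs "HOL-Complex_Analysis.Laurent_Convergence"
begin

text \<open>
  From \<open>A T\<^sup>n = C\<^sup>n A\<close> one gets \<open>\<parallel>C\<^sup>n A x\<parallel> \<le> \<parallel>A\<parallel> \<parallel>T\<^sup>n x\<parallel>\<close>, which settles the Deddens algebras.
  Similar operators have the same spectrum, hence the same \<open>d\<^sub>m\<close>; as
  \<open>\<parallel>R\<^sub>m(T) x\<parallel>\<^sup>2 = \<Sum>\<^sub>n d\<^sub>m\<^sup>2\<^sup>n \<parallel>T\<^sup>n x\<parallel>\<^sup>2\<close>, the same comparison gives
  \<open>\<parallel>R\<^sub>m(C) A x\<parallel> \<le> \<parallel>A\<parallel> \<parallel>R\<^sub>m(T) x\<parallel>\<close>, uniformly in \<open>m\<close>. Everything else serves to show that the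
  formula for \<open>\<parallel>R\<^sub>m x\<parallel>\<close> is legitimate: the adjoint exists, the series converges in norm because
  \<open>d\<^sub>m r(T) < 1\<close>, and its sum has an invertible positive square root.
\<close>

section \<open>The scalar product\<close>

lemma cinner_add_right: "cinner x (y + z) = cinner x y + cinner x (z :: 'a::complex_hilbert)"
  by (metis cinner_commute cinner_add_left complex_cnj_add)

lemma cinner_scaleC_right: "cinner x (a *\<^sub>C y) = cnj a * cinner x (y :: 'a::complex_hilbert)"
  by (metis cinner_commute cinner_scaleC_left complex_cnj_mult)

lemma cinner_scaleR_left: "cinner (r *\<^sub>R x) y = r *\<^sub>R cinner x (y :: 'a::complex_hilbert)"
  by (metis scaleC_of_real cinner_scaleC_left scaleR_conv_of_real)

lemma cinner_scaleR_right: "cinner x (r *\<^sub>R y) = r *\<^sub>R cinner x (y :: 'a::complex_hilbert)"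
  by (metis scaleC_of_real cinner_scaleC_right scaleR_conv_of_real complex_cnj_complex_of_real)

lemma norm_add_square:
  "(norm (x + y))\<^sup>2 = (norm x)\<^sup>2 + 2 * Re (cinner x y) + (norm (y :: 'a::complex_hilbert))\<^sup>2"
proof -
  have "complex_of_real ((norm (x + y))\<^sup>2) = cinner x x + (cinner x y + cnj (cinner x y)) + cinner y y"
    by (simp only: cinner_self[symmetric] cinner_add_left cinner_add_right cinner_commute[of y x]
        add_ac)
  also have "\<dots> = complex_of_real ((norm x)\<^sup>2 + 2 * Re (cinner x y) + (norm y)\<^sup>2)"
    by (simp add: complex_add_cnj cinner_self)
  finally show ?thesis
    using of_real_eq_iff by blast
qed

text \<open>Cauchy-Schwarz: the choice of \<open>a\<close> makes \<open>x + a *\<^sub>C y\<close>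
  the component of \<open>x\<close> orthogonal to \<open>y\<close>, and its squared norm is
  nonnegative.\<close>

lemma norm_cinner_le: "cmod (cinner x y) \<le> norm x * norm (y :: 'a::complex_hilbert)"
proof (cases "y = 0")
  case True
  have "cinner x 0 = 0"
    using cinner_scaleR_right[of x 0 0] by simp
  then show ?thesis using True by simp
next
  case False
  define N where "N = (norm y)\<^sup>2"
  have N: "N > 0" using False by (simp add: N_def)
  define a where "a = - cinner x y / of_real N"
  have "(0::real) \<le> (norm (x + a *\<^sub>C y))\<^sup>2"
    by simp
  also have "\<dots> = (norm x)\<^sup>2 + 2 * Re (cnj a * cinner x y) + (cmod a)\<^sup>2 * N"
    by (simp add: norm_add_square cinner_scaleC_right norm_scaleC power_mult_distrib N_def)
  also have "cnj a * cinner x y = of_real (- ((cmod (cinner x y))\<^sup>2 / N))"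
    using complex_norm_square[of "cinner x y"] by (simp add: a_def mult.commute)
  also have "(cmod a)\<^sup>2 * N = (cmod (cinner x y))\<^sup>2 / N"
    using N by (simp add: a_def norm_divide power_divide power2_eq_square)
  finally have "(cmod (cinner x y))\<^sup>2 / N \<le> (norm x)\<^sup>2"
    by simp
  then have "(cmod (cinner x y))\<^sup>2 \<le> (norm x * norm y)\<^sup>2"
    using N by (simp add: field_simps N_def)
  then show ?thesis
    by (rule power2_le_imp_le) simp
qed

text \<open>Conjugate linearity in the second argument is still real linearity, so continuity,
  limits and differences of scalar products come from the general theory of bounded bilinear
  maps.\<close>

interpretation cinner: bounded_bilinear "cinner :: 'a::complex_hilbert \<Rightarrow> 'a \<Rightarrow> complex"
proof
  show "\<exists>K. \<forall>(a::'a) b. cmod (cinner a b) \<le> norm a * norm b * K"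
    by (intro exI[of _ 1]) (simp add: norm_cinner_le)
qed (rule cinner_add_left cinner_add_right cinner_scaleR_left cinner_scaleR_right)+

lemma cinner_extensionality:
  assumes "\<And>z. cinner z x = cinner z (y :: 'a::complex_hilbert)"
  shows "x = y"
proof -
  have "cinner (x - y) (x - y) = 0"
    by (simp add: cinner.diff_right assms)
  then show ?thesis
    by (simp add: cinner_self)
qed

section \<open>Riesz representation and adjoints\<close>

text \<open>The representing vector minimises \<open>\<parallel>x\<parallel>\<^sup>2 - 2 Re f x\<close>.\<close>

lemma riesz_representation:
  fixes f :: "'a::complex_hilbert \<Rightarrow> complex"
  assumes lin: "bounded_linear f" and hom: "\<And>a x. f (a *\<^sub>C x) = a * f x"
  shows "\<exists>y. \<forall>x. f x = cinner x y"
proof -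
  interpret f: bounded_linear f by (rule lin)
  define q where "q x = (norm x)\<^sup>2 - 2 * Re (f x)" for x
  obtain K where K: "\<And>x. cmod (f x) \<le> norm x * K"
    using f.bounded by blast
  have lower: "q x \<ge> - K\<^sup>2" for x
  proof -
    have "Re (f x) \<le> norm x * K"
      using K[of x] complex_Re_le_cmod[of "f x"] by linarith
    moreover have "0 \<le> (norm x - K)\<^sup>2"
      by simp
    ultimately show ?thesis
      unfolding q_def power2_diff by linarith
  qed
  define m where "m = Inf (range q)"
  have bdd: "bdd_below (range q)"
    using lower by (auto intro!: bdd_belowI2)
  have m_le: "m \<le> q x" for x
    unfolding m_def by (rule cInf_lower[OF _ bdd]) simp
  have "\<exists>x. q x < m + 1 / real (Suc n)" for n
  proof -
    have "Inf (range q) < m + 1 / real (Suc n)"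
      by (simp add: m_def)
    then show ?thesis
      using cInf_lessD[of "range q"] by fastforce
  qed
  then obtain X where X: "\<And>n. q (X n) < m + 1 / real (Suc n)"
    by metis
  \<comment> \<open>Parallelogram law: evaluating \<open>q\<close> at the midpoint shows that two
    almost minimal points are close to each other.\<close>
  have para: "(norm (x - y))\<^sup>2 \<le> 2 * q x + 2 * q y - 4 * m" for x y
  proof -
    define z where "z = (1/2) *\<^sub>R (x + y)"
    have "q z = (norm (x + y))\<^sup>2 / 4 - Re (f x) - Re (f y)"
      by (simp add: z_def q_def f.scaleR f.add power2_eq_square add_divide_distrib)
    moreover have "(norm (x - y))\<^sup>2 = (norm x)\<^sup>2 - 2 * Re (cinner x y) + (norm y)\<^sup>2"
      using norm_add_square[of x "- y"] by (simp add: cinner.minus_right)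
    moreover have "2 * q x + 2 * q y = 2 * (norm x)\<^sup>2 + 2 * (norm y)\<^sup>2 - 4 * Re (f x) - 4 * Re (f y)"
      by (simp add: q_def)
    ultimately have "(norm (x - y))\<^sup>2 = 2 * q x + 2 * q y - 4 * q z"
      using norm_add_square[of x y] by linarith
    then show ?thesis
      using m_le[of z] by simp
  qed
  have "Cauchy X"
  proof (rule metric_CauchyI)
    fix e :: real assume e: "e > 0"
    obtain N where N: "inverse (real (Suc N)) < e\<^sup>2 / 4"
      using reals_Archimedean[of "e\<^sup>2 / 4"] e by auto
    have small: "q (X k) - m < e\<^sup>2 / 4" if "k \<ge> N" for k
    proof -
      have "1 / real (Suc k) \<le> inverse (real (Suc N))"
        using that by (simp add: field_simps)
      then show ?thesis
        using X[of k] N by linarith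
    qed
    have "dist (X k) (X l) < e" if "k \<ge> N" "l \<ge> N" for k l
    proof -
      have "(norm (X k - X l))\<^sup>2 < e\<^sup>2"
        using para[of "X k" "X l"] small[OF that(1)] small[OF that(2)] by linarith
      then show ?thesis
        using e by (simp add: dist_norm power2_less_imp_less)
    qed
    then show "\<exists>M. \<forall>k\<ge>M. \<forall>n\<ge>M. dist (X k) (X n) < e"
      by blast
  qed
  then obtain y where y: "X \<longlonglongrightarrow> y"
    using Cauchy_convergent_iff convergent_def by blast
  have "(\<lambda>n. q (X n)) \<longlonglongrightarrow> q y"
    unfolding q_def by (intro tendsto_intros f.tendsto y)
  moreover have "(\<lambda>n. m + 1 / real (Suc n)) \<longlonglongrightarrow> m + 0"
    by (intro tendsto_intros LIMSEQ_Suc[OF lim_1_over_n])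
  ultimately have "q y \<le> m + 0"
    using X by (intro LIMSEQ_le[of "\<lambda>n. q (X n)"]) (auto intro: less_imp_le)
  then have min: "q y \<le> q x" for x
    using m_le[of x] by linarith
  have ReEq: "Re (f z) = Re (cinner z y)" for z
  proof -
    define c where "c = Re (cinner z y) - Re (f z)"
    \<comment> \<open>Perturbing the minimiser \<open>y\<close> in the direction \<open>z\<close>:
      the linear coefficient \<open>2 * c\<close> of this quadratic in \<open>t\<close> has to
      vanish.\<close>
    have quad: "0 \<le> 2 * t * c + t\<^sup>2 * (norm z)\<^sup>2" for t
    proof -
      have "q (t *\<^sub>R z + y) = q y + 2 * t * c + t\<^sup>2 * (norm z)\<^sup>2"
        by (simp add: q_def norm_add_square f.add f.scaleR cinner_scaleR_left c_def
            power_mult_distrib right_diff_distrib)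
      then show ?thesis
        using min[of "t *\<^sub>R z + y"] by linarith
    qed
    \<comment> \<open>With \<open>t = - c / D\<close> the quadratic equals
      \<open>- (c\<^sup>2 * (D + 1)) / D\<^sup>2\<close>. The summand 1 keeps the division
      legitimate when \<open>z = 0\<close>.\<close>
    define D where "D = (norm z)\<^sup>2 + 1"
    have D: "D > 0" by (simp add: D_def add_nonneg_pos)
    have "D\<^sup>2 * (2 * (- c / D) * c + (- c / D)\<^sup>2 * (D - 1)) = - (c\<^sup>2 * (D + 1))"
      using D by (simp add: power2_eq_square distrib_left right_diff_distrib)
    moreover have "0 \<le> D\<^sup>2 * (2 * (- c / D) * c + (- c / D)\<^sup>2 * (D - 1))"
      using quad[of "- c / D"] by (intro mult_nonneg_nonneg) (simp_all add: D_def)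
    ultimately have "c\<^sup>2 * (D + 1) \<le> 0"
      by linarith
    then have "c = 0"
      using D by (simp add: mult_le_0_iff)
    then show ?thesis by (simp add: c_def)
  qed
  \<comment> \<open>By complex linearity the imaginary part of \<open>f\<close> at \<open>z\<close>
    is its real part at \<open>(- \<i>) *\<^sub>C z\<close>.\<close>
  have "Im (f z) = Im (cinner z y)" for z
    using ReEq[of "(- \<i>) *\<^sub>C z"] by (simp add: hom cinner_scaleC_left)
  then show ?thesis
    using ReEq by (auto simp: complex_eq_iff)
qed

section \<open>Existence of adjoints and their norm bound\<close>

lemma bounded_opsD: "T \<in> bounded_ops \<Longrightarrow> blinfun_apply T (a *\<^sub>C x) = a *\<^sub>C blinfun_apply T x"
  by (simp add: bounded_ops_def)

text \<open>Take \<open>x = S y\<close>. Here \<open>S\<close> is a mere function, because the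
  estimate serves to prove that the adjoint is bounded; later it also bounds the powers of the
  adjoint.\<close>

lemma norm_adjoint_apply_le:
  fixes T :: "'a::complex_hilbert \<Rightarrow>\<^sub>L 'a" and S :: "'a \<Rightarrow> 'a"
  assumes "\<And>x y. cinner (T x) y = cinner x (S y)"
  shows "norm (S y) \<le> norm T * norm y"
proof -
  have "norm (S y) * norm (S y) = cmod (cinner (T (S y)) y)"
    by (simp add: assms cinner_self norm_mult power2_eq_square)
  also have "\<dots> \<le> norm (T (S y)) * norm y"
    by (rule norm_cinner_le)
  also have "\<dots> \<le> norm T * norm (S y) * norm y"
    by (simp add: mult_right_mono norm_blinfun)
  finally show ?thesis
    by (cases "S y = 0") (simp_all add: mult.commute mult.left_commute)
qed

text \<open>Riesz representation for the functional \<open>x \<mapsto> cinner (T x) y\<close>, one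
  \<open>y\<close> at a time; linearity of \<open>S\<close> comes from uniqueness of the
  representing vector.\<close>

lemma adjoint_exists:
  fixes T :: "'a::complex_hilbert \<Rightarrow>\<^sub>L 'a"
  assumes "T \<in> bounded_ops"
  shows "\<exists>S. S \<in> bounded_ops \<and> (\<forall>x y. cinner (T x) y = cinner x (S y))"
proof -
  have "\<exists>z. \<forall>x. cinner (T x) y = cinner x z" for y
    by (rule riesz_representation)
      (auto intro: bounded_linear_compose[OF cinner.bounded_linear_left]
        simp: blinfun.bounded_linear_right bounded_opsD[OF assms] cinner_scaleC_left)
  then obtain S where S: "\<And>x y. cinner (T x) y = cinner x (S y)"
    by metis
  have bound: "norm (S y) \<le> norm y * norm T" for y
    using norm_adjoint_apply_le[OF S] by (simp add: mult.commute)
  have "bounded_linear S"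
  proof (rule bounded_linear_intro)
    show "S (x + y) = S x + S y" for x y
      by (rule cinner_extensionality) (simp add: cinner_add_right flip: S)
    show "S (r *\<^sub>R x) = r *\<^sub>R S x" for r x
      by (rule cinner_extensionality) (simp add: cinner_scaleR_right flip: S)
  qed (rule bound)
  then have S_apply: "blinfun_apply (Blinfun S) = S"
    by (rule bounded_linear_Blinfun_apply)
  have "S (a *\<^sub>C x) = a *\<^sub>C S x" for a x
    by (rule cinner_extensionality) (simp add: cinner_scaleC_right flip: S)
  then have "Blinfun S \<in> bounded_ops"
    by (simp add: bounded_ops_def S_apply)
  then show ?thesis
    using S S_apply by metis
qed

lemma
  assumes "T \<in> bounded_ops"
  shows op_adjoint_bounded_ops: "op_adjoint T \<in> bounded_ops"
    and cinner_op_adjoint: "cinner (blinfun_apply T x) y = cinner x (blinfun_apply (op_adjoint T) y)"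
  using someI_ex[OF adjoint_exists[OF assms]] unfolding op_adjoint_def by blast+

section \<open>Inverses\<close>

lemma bounded_ops_id [simp]: "id_blinfun \<in> bounded_ops"
  by (simp add: bounded_ops_def)

lemma bounded_ops_zero [simp]: "0 \<in> bounded_ops"
  unfolding bounded_ops_def
  by (simp add: linear_0[OF bounded_linear.linear[OF bounded_linear_scaleC]])

lemma bounded_ops_add: "S \<in> bounded_ops \<Longrightarrow> T \<in> bounded_ops \<Longrightarrow> S + T \<in> bounded_ops"
  by (simp add: bounded_ops_def blinfun.add_left scaleC_add_right)

lemma bounded_ops_scaleR: "T \<in> bounded_ops \<Longrightarrow> r *\<^sub>R T \<in> bounded_ops"
  by (simp add: bounded_ops_def blinfun.scaleR_left scaleC_scaleC mult.commute flip: scaleC_of_real)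

lemma bounded_ops_diff: "S \<in> bounded_ops \<Longrightarrow> T \<in> bounded_ops \<Longrightarrow> S - T \<in> bounded_ops"
  using bounded_ops_add[of S "(-1) *\<^sub>R T"] bounded_ops_scaleR[of T "-1"] by simp

lemma bounded_ops_compose: "S \<in> bounded_ops \<Longrightarrow> T \<in> bounded_ops \<Longrightarrow> S o\<^sub>L T \<in> bounded_ops"
  by (simp add: bounded_ops_def)

lemma bounded_ops_op_power: "T \<in> bounded_ops \<Longrightarrow> op_power T n \<in> bounded_ops"
  by (induction n) (simp_all add: op_power_def bounded_ops_compose)

text \<open>Evaluation at a point is continuous, so complex linearity survives norm limits. This
  gives the completeness behind the fixed point arguments and keeps sums of operator series in the
  algebra.\<close>

lemma closed_bounded_ops: "closed bounded_ops"
  unfolding bounded_ops_def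
  by (intro closed_Collect_all closed_Collect_eq continuous_intros
      linear_continuous_on[OF bounded_linear_compose[OF bounded_linear_scaleC]]
      blinfun.bounded_linear_left)

section \<open>Composition and inverses\<close>

lemma blinfun_compose_assoc: "(R o\<^sub>L S) o\<^sub>L T = R o\<^sub>L (S o\<^sub>L T)"
  by (rule blinfun_eqI) simp

lemma blinfun_compose_id [simp]: "id_blinfun o\<^sub>L T = T" "T o\<^sub>L id_blinfun = T"
  by (auto intro: blinfun_eqI)

lemma is_op_inverse_unique:
  assumes "is_op_inverse T S" "is_op_inverse T S'"
  shows "S = S'"
  using assms unfolding is_op_inverse_def by (metis blinfun_compose_assoc blinfun_compose_id)

lemma op_inverse_eqI: "is_op_inverse T S \<Longrightarrow> op_inverse T = S"
  unfolding op_inverse_def using is_op_inverse_unique by blast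

lemma is_op_inverse_op_inverse: "op_invertible T \<Longrightarrow> is_op_inverse T (op_inverse T)"
  unfolding op_invertible_def using op_inverse_eqI by metis

lemma
  assumes "op_invertible T"
  shows op_inverse_bounded_ops: "op_inverse T \<in> bounded_ops"
    and op_inverse_left: "blinfun_apply (op_inverse T) (blinfun_apply T x) = x"
    and op_inverse_right: "blinfun_apply T (blinfun_apply (op_inverse T) x) = x"
proof -
  have inv: "op_inverse T \<in> bounded_ops" "op_inverse T o\<^sub>L T = id_blinfun"
      "T o\<^sub>L op_inverse T = id_blinfun"
    using is_op_inverse_op_inverse[OF assms] by (simp_all add: is_op_inverse_def)
  show "op_inverse T \<in> bounded_ops" by (rule inv)
  show "op_inverse T (T x) = x"
    using blinfun_apply_blinfun_compose[of "op_inverse T" T x] by (simp add: inv)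
  show "T (op_inverse T x) = x"
    using blinfun_apply_blinfun_compose[of T "op_inverse T" x] by (simp add: inv)
qed

lemma op_invertible_op_inverse:
  assumes "op_invertible T" "T \<in> bounded_ops"
  shows "op_invertible (op_inverse T)" "op_inverse (op_inverse T) = T"
proof -
  have "is_op_inverse (op_inverse T) T"
    using is_op_inverse_op_inverse[OF assms(1)] assms(2) by (simp add: is_op_inverse_def)
  then show "op_invertible (op_inverse T)" "op_inverse (op_inverse T) = T"
    by (auto simp: op_invertible_def op_inverse_eqI)
qed

lemma op_invertible_compose:
  assumes "op_invertible S" "op_invertible T"
  shows "op_invertible (S o\<^sub>L T)"
proof -
  have "is_op_inverse (S o\<^sub>L T) (op_inverse T o\<^sub>L op_inverse S)"
    unfolding is_op_inverse_def using assms
    by (auto intro!: blinfun_eqI bounded_ops_compose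
        simp: op_inverse_bounded_ops op_inverse_left op_inverse_right)
  then show ?thesis
    unfolding op_invertible_def by blast
qed

lemma op_invertible_id [simp]: "op_invertible id_blinfun"
  unfolding op_invertible_def is_op_inverse_def by (intro exI[of _ id_blinfun]) simp

text \<open>One-sided inverses on both sides coincide, so the complex linearity of \<open>L\<close>
  passes to the two-sided inverse.\<close>

lemma op_invertible_if_left_right:
  assumes "L \<in> bounded_ops" "L o\<^sub>L T = id_blinfun" "T o\<^sub>L R = id_blinfun"
  shows "op_invertible T"
proof -
  have "L = R"
    by (metis assms(2,3) blinfun_compose_assoc blinfun_compose_id)
  then show ?thesis
    using assms unfolding op_invertible_def is_op_inverse_def by blast
qed

text \<open>The Neumann series in fixed point form:
  \<open>Y \<mapsto> id_blinfun + (X o\<^sub>L Y)\<close> and its mirror image contract by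
  \<open>norm X\<close>. The first fixed point is a right inverse, the second a left
  inverse.\<close>

lemma op_invertible_id_minus:
  fixes X :: "'a::complex_hilbert \<Rightarrow>\<^sub>L 'a"
  assumes X: "X \<in> bounded_ops" and "norm X < 1"
  shows "op_invertible (id_blinfun - X)"
proof -
  have complete: "complete (bounded_ops :: ('a \<Rightarrow>\<^sub>L 'a) set)" "(bounded_ops :: ('a \<Rightarrow>\<^sub>L 'a) set) \<noteq> {}"
    using bounded_ops_id by (auto simp: complete_eq_closed closed_bounded_ops simp del: bounded_ops_id)
  have "\<exists>!Z\<in>bounded_ops. id_blinfun + (X o\<^sub>L Z) = Z"
  proof (rule Banach_fix[OF complete norm_ge_zero[of X] \<open>norm X < 1\<close>])
    show "dist (id_blinfun + (X o\<^sub>L Y)) (id_blinfun + (X o\<^sub>L Z)) \<le> norm X * dist Y Z" for Y Z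
      using norm_blinfun_compose[of X "Y - Z"]
      by (simp add: dist_norm bounded_bilinear.diff_right[OF bounded_bilinear_blinfun_compose])
  qed (auto intro!: bounded_ops_add bounded_ops_compose X)
  then obtain Z where Z: "id_blinfun + (X o\<^sub>L Z) = Z" by blast
  have "\<exists>!Z\<in>bounded_ops. id_blinfun + (Z o\<^sub>L X) = Z"
  proof (rule Banach_fix[OF complete norm_ge_zero[of X] \<open>norm X < 1\<close>])
    show "dist (id_blinfun + (Y o\<^sub>L X)) (id_blinfun + (Z o\<^sub>L X)) \<le> norm X * dist Y Z" for Y Z
      using norm_blinfun_compose[of "Y - Z" X]
      by (simp add: dist_norm bounded_bilinear.diff_left[OF bounded_bilinear_blinfun_compose] mult.commute)
  qed (auto intro!: bounded_ops_add bounded_ops_compose X)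
  then obtain W where W: "W \<in> bounded_ops" "id_blinfun + (W o\<^sub>L X) = W" by blast
  have "W o\<^sub>L (id_blinfun - X) = id_blinfun"
    using W(2) by (simp add: bounded_bilinear.diff_right[OF bounded_bilinear_blinfun_compose] algebra_simps)
  moreover have "(id_blinfun - X) o\<^sub>L Z = id_blinfun"
    using Z by (simp add: bounded_bilinear.diff_left[OF bounded_bilinear_blinfun_compose] algebra_simps)
  ultimately show ?thesis
    using W(1) by (rule_tac op_invertible_if_left_right)
qed

section \<open>Square roots\<close>

definition selfadjoint_op :: "('a::complex_hilbert \<Rightarrow>\<^sub>L 'a) \<Rightarrow> bool" where
  "selfadjoint_op T \<longleftrightarrow> (\<forall>x y. cinner (T x) y = cinner x (T y))"

text \<open>Polarization: reality at \<open>x + y\<close> settles the imaginary parts, and replacing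
  \<open>y\<close> by \<open>\<i> *\<^sub>C y\<close> settles the real parts.\<close>

lemma selfadjoint_op_if_real:
  fixes T :: "'a::complex_hilbert \<Rightarrow>\<^sub>L 'a"
  assumes T: "T \<in> bounded_ops" and real: "\<And>x. Im (cinner (T x) x) = 0"
  shows "selfadjoint_op T"
proof -
  have sum0: "Im (cinner (T x) y) + Im (cinner (T y) x) = 0" for x y
    using real[of "x + y"] real[of x] real[of y]
    by (simp add: blinfun.add_right cinner_add_left cinner_add_right)
  have "cinner (T x) y = cinner x (T y)" for x y
  proof -
    have "Im (cinner (T x) y) = - Im (cinner (T y) x)"
      using sum0[of x y] by simp
    moreover have "Re (cinner (T x) y) = Re (cinner (T y) x)"
      using sum0[of x "\<i> *\<^sub>C y"]
      by (simp add: bounded_opsD[OF T] cinner_scaleC_left cinner_scaleC_right)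
    ultimately have "cinner (T x) y = cnj (cinner (T y) x)"
      by (simp add: complex_eq_iff)
    then show ?thesis
      using cinner_commute by metis
  qed
  then show ?thesis by (simp add: selfadjoint_op_def)
qed

lemma selfadjoint_op_real: "selfadjoint_op T \<Longrightarrow> Im (cinner (blinfun_apply T x) x) = 0"
proof -
  assume "selfadjoint_op T"
  then have "cinner (T x) x = cnj (cinner (T x) x)"
    unfolding selfadjoint_op_def by (metis cinner_commute)
  then have "Im (cinner (T x) x) = - Im (cinner (T x) x)"
    by (subst (asm) complex_eq_iff) (simp only: cnj.simps)
  then show ?thesis by simp
qed

text \<open>Expanding the square of \<open>norm (x - t *\<^sub>R P x)\<close> bounds it by
  \<open>(1 - 2 * t + t\<^sup>2 * K\<^sup>2) * (norm x)\<^sup>2\<close>, and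
  \<open>t = 1 / K\<^sup>2\<close> turns the factor into \<open>1 - t\<close>. Inverting
  \<open>P\<close> and extracting its root are thereby reduced to operators close to the
  identity.\<close>

lemma id_minus_scaled_op_contraction:
  fixes P :: "'a::complex_hilbert \<Rightarrow>\<^sub>L 'a"
  assumes lower: "\<And>x. (norm x)\<^sup>2 \<le> Re (cinner (P x) x)"
  obtains t q where "t > 0" "0 \<le> q" "q < 1" "norm (id_blinfun - t *\<^sub>R P) \<le> q"
proof -
  \<comment> \<open>The added 1 ensures \<open>t \<le> 1\<close>, so that
    \<open>sqrt (1 - t)\<close> makes sense, even on the zero space.\<close>
  define K where "K = norm P + 1"
  have K: "K \<ge> 1" "norm P \<le> K" by (simp_all add: K_def)
  define t where "t = 1 / K\<^sup>2"
  have K2: "K\<^sup>2 \<ge> 1" using K by (simp add: one_le_power)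
  then have t: "0 < t" "t \<le> 1" using K by (auto simp: t_def)
  define q where "q = sqrt (1 - t)"
  have "norm (id_blinfun - t *\<^sub>R P) \<le> q"
  proof (rule norm_blinfun_bound)
    show "0 \<le> q" using t by (simp add: q_def)
    fix x
    have "norm (P x) \<le> K * norm x"
      using norm_blinfun[of P x] K(2) by (meson mult_right_mono norm_ge_zero order_trans)
    then have "(norm (P x))\<^sup>2 \<le> K\<^sup>2 * (norm x)\<^sup>2"
      by (metis norm_ge_zero power_mono power_mult_distrib)
    then have "t\<^sup>2 * (norm (P x))\<^sup>2 \<le> t\<^sup>2 * (K\<^sup>2 * (norm x)\<^sup>2)"
      by (rule mult_left_mono) simp
    also have "t\<^sup>2 * (K\<^sup>2 * (norm x)\<^sup>2) = t * (norm x)\<^sup>2"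
      using K by (simp add: t_def power2_eq_square)
    finally have a: "t\<^sup>2 * (norm (P x))\<^sup>2 \<le> t * (norm x)\<^sup>2" .
    have b: "t * (norm x)\<^sup>2 \<le> t * Re (cinner (P x) x)"
      using lower[of x] t by simp
    have "Re (cinner x (P x)) = Re (cinner (P x) x)"
      by (subst cinner_commute) simp
    then have "(norm (x - t *\<^sub>R P x))\<^sup>2 =
        (norm x)\<^sup>2 - 2 * (t * Re (cinner (P x) x)) + t\<^sup>2 * (norm (P x))\<^sup>2"
      using norm_add_square[of x "- (t *\<^sub>R P x)"]
      by (simp add: cinner.minus_right cinner_scaleR_right power_mult_distrib)
    also have "\<dots> \<le> (norm x)\<^sup>2 - t * (norm x)\<^sup>2"
      using a b by linarith
    also have "\<dots> = (q * norm x)\<^sup>2"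
      using t by (simp add: q_def power_mult_distrib algebra_simps)
    finally have "norm (x - t *\<^sub>R P x) \<le> q * norm x"
      by (rule power2_le_imp_le) (use t in \<open>simp add: q_def\<close>)
    then show "norm ((id_blinfun - t *\<^sub>R P) x) \<le> q * norm x"
      by (simp add: blinfun.diff_left blinfun.scaleR_left)
  qed
  moreover have "0 \<le> q" "q < 1"
    using t by (simp_all add: q_def)
  ultimately show ?thesis
    using that t by blast
qed

lemma op_invertible_scaleR:
  assumes "op_invertible (t *\<^sub>R P)"
  shows "op_invertible P"
proof -
  have "is_op_inverse P (t *\<^sub>R op_inverse (t *\<^sub>R P))"
    using is_op_inverse_op_inverse[OF assms] unfolding is_op_inverse_def
    by (simp add: bounded_ops_scaleR bounded_bilinear.scaleR_left[OF bounded_bilinear_blinfun_compose]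
        bounded_bilinear.scaleR_right[OF bounded_bilinear_blinfun_compose])
  then show ?thesis unfolding op_invertible_def by blast
qed

text \<open>An instance of Lax-Milgram: a suitable positive multiple of \<open>P\<close> is the
  identity minus an operator of norm below 1.\<close>

lemma op_invertible_if_bounded_below:
  fixes P :: "'a::complex_hilbert \<Rightarrow>\<^sub>L 'a"
  assumes P: "P \<in> bounded_ops" and lower: "\<And>x. (norm x)\<^sup>2 \<le> Re (cinner (P x) x)"
  shows "op_invertible P"
proof -
  obtain t q where "t > 0" "q < 1" "norm (id_blinfun - t *\<^sub>R P) \<le> q"
    using id_minus_scaled_op_contraction[OF lower] by metis
  then have "op_invertible (id_blinfun - (id_blinfun - t *\<^sub>R P))"
    by (intro op_invertible_id_minus bounded_ops_diff bounded_ops_scaleR P) auto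
  then show ?thesis
    by (rule_tac op_invertible_scaleR[of t]) simp
qed

text \<open>
  For \<open>P = (1 - X) / t\<close> with \<open>\<parallel>X\<parallel> < 1\<close>, the root is a multiple of \<open>1 - Y\<close>, where \<open>Y\<close> is
  the fixed point of the contraction \<open>Y \<mapsto> (X + Y\<^sup>2) / 2\<close>.
\<close>

lemma positive_sqrt_exists:
  fixes P :: "'a::complex_hilbert \<Rightarrow>\<^sub>L 'a"
  assumes P: "P \<in> bounded_ops" and real: "\<And>x. Im (cinner (P x) x) = 0"
    and lower: "\<And>x. (norm x)\<^sup>2 \<le> Re (cinner (P x) x)"
  shows "\<exists>R. positive_op R \<and> R o\<^sub>L R = P"
proof -
  note bb = bounded_bilinear_blinfun_compose
  note compose_simps = bounded_bilinear.diff_left[OF bb] bounded_bilinear.diff_right[OF bb]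
    bounded_bilinear.scaleR_left[OF bb] bounded_bilinear.scaleR_right[OF bb]
  obtain t q where t: "t > 0" and q: "0 \<le> q" "q < 1" and X_norm: "norm (id_blinfun - t *\<^sub>R P) \<le> q"
    using id_minus_scaled_op_contraction[OF lower] by metis
  define X where "X = id_blinfun - t *\<^sub>R P"
  have X: "X \<in> bounded_ops"
    unfolding X_def by (intro bounded_ops_diff bounded_ops_scaleR P bounded_ops_id)
  have X_self: "cinner (X x) y = cinner x (X y)" for x y
    using selfadjoint_op_if_real[OF P real]
    by (simp add: X_def selfadjoint_op_def blinfun.diff_left blinfun.scaleR_left cinner.diff_left
        cinner.diff_right cinner_scaleR_left cinner_scaleR_right)
  \<comment> \<open>On the ball of radius \<open>q\<close> the map contracts by \<open>q\<close>.
    Self-adjointness is built into the domain because the positivity of the root needs it for the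
    fixed point.\<close>
  define S where "S = bounded_ops \<inter> {Y. selfadjoint_op Y} \<inter> cball (0 :: 'a \<Rightarrow>\<^sub>L 'a) q"
  have closed_self: "closed {Y :: 'a \<Rightarrow>\<^sub>L 'a. selfadjoint_op Y}"
    unfolding selfadjoint_op_def
    by (intro closed_Collect_all closed_Collect_eq cinner.continuous_on continuous_intros)
  have "\<exists>!Y\<in>S. (1/2) *\<^sub>R (X + (Y o\<^sub>L Y)) = Y"
  proof (rule Banach_fix[OF _ _ q])
    show "complete S"
      unfolding S_def complete_eq_closed by (intro closed_Int closed_bounded_ops closed_self closed_cball)
    have "0 \<in> S"
      using q by (simp add: S_def selfadjoint_op_def cinner.zero_left cinner.zero_right)
    then show "S \<noteq> {}" by blast
    show "(\<lambda>Y. (1/2) *\<^sub>R (X + (Y o\<^sub>L Y))) ` S \<subseteq> S"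
    proof clarify
      fix Y assume "Y \<in> S"
      then have Y: "Y \<in> bounded_ops" "norm Y \<le> q" and Y_self: "\<And>x y. cinner (Y x) y = cinner x (Y y)"
        by (simp_all add: S_def selfadjoint_op_def)
      have "norm (Y o\<^sub>L Y) \<le> norm Y * norm Y"
        by (rule norm_blinfun_compose)
      also have "\<dots> \<le> q * 1"
        using Y(2) q by (intro mult_mono) auto
      finally have "norm (X + (Y o\<^sub>L Y)) \<le> q + q"
        using X_norm norm_triangle_ineq[of X "Y o\<^sub>L Y"] by (simp add: X_def)
      then show "(1/2) *\<^sub>R (X + (Y o\<^sub>L Y)) \<in> S"
        by (simp add: S_def selfadjoint_op_def bounded_ops_scaleR bounded_ops_add bounded_ops_compose X Y
            blinfun.scaleR_left blinfun.add_left cinner_scaleR_left cinner_scaleR_right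
            cinner_add_left cinner_add_right X_self Y_self)
    qed
    show "dist ((1/2) *\<^sub>R (X + (Y o\<^sub>L Y))) ((1/2) *\<^sub>R (X + (Z o\<^sub>L Z))) \<le> q * dist Y Z"
      if "Y \<in> S" "Z \<in> S" for Y Z
    proof -
      have n: "norm Y \<le> q" "norm Z \<le> q" using that by (simp_all add: S_def)
      \<comment> \<open>Factorization of a difference of squares without commutativity.\<close>
      have "(1/2) *\<^sub>R (X + (Y o\<^sub>L Y)) - (1/2) *\<^sub>R (X + (Z o\<^sub>L Z))
          = (1/2) *\<^sub>R ((Y o\<^sub>L (Y - Z)) + ((Y - Z) o\<^sub>L Z))"
        by (simp add: compose_simps algebra_simps)
      then have "dist ((1/2) *\<^sub>R (X + (Y o\<^sub>L Y))) ((1/2) *\<^sub>R (X + (Z o\<^sub>L Z)))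
          = (1/2) * norm ((Y o\<^sub>L (Y - Z)) + ((Y - Z) o\<^sub>L Z))"
        by (simp only: dist_norm norm_scaleR)
      also have "\<dots> \<le> (1/2) * (norm (Y o\<^sub>L (Y - Z)) + norm ((Y - Z) o\<^sub>L Z))"
        by (simp add: norm_triangle_ineq)
      also have "\<dots> \<le> (1/2) * (norm Y * norm (Y - Z) + norm (Y - Z) * norm Z)"
        using norm_blinfun_compose[of Y "Y - Z"] norm_blinfun_compose[of "Y - Z" Z] by simp
      also have "\<dots> \<le> (1/2) * (q * norm (Y - Z) + norm (Y - Z) * q)"
        using n by (intro mult_left_mono add_mono mult_right_mono) auto
      finally show ?thesis by (simp add: dist_norm)
    qed
  qed
  then obtain Y where "Y \<in> S" and fix_Y: "(1/2) *\<^sub>R (X + (Y o\<^sub>L Y)) = Y" by blast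
  then have Y: "Y \<in> bounded_ops" "norm Y \<le> q" and Y_self: "selfadjoint_op Y"
    by (simp_all add: S_def)
  have "2 *\<^sub>R Y = X + (Y o\<^sub>L Y)"
    by (subst fix_Y[symmetric]) simp
  then have YY: "Y o\<^sub>L Y = Y + Y - X"
    by (simp add: scaleR_2 algebra_simps)
  \<comment> \<open>The fixed point equation says that the square of \<open>id_blinfun - Y\<close>
    is \<open>id_blinfun - X\<close>, which is \<open>t *\<^sub>R P\<close>; the factor
    \<open>1 / sqrt t\<close> removes \<open>t\<close>.\<close>
  define c where "c = 1 / sqrt t"
  have c: "c > 0" "c * c * t = 1" using t by (simp_all add: c_def)
  define R where "R = c *\<^sub>R (id_blinfun - Y)"
  have "R o\<^sub>L R = (c * c) *\<^sub>R ((id_blinfun - Y) o\<^sub>L (id_blinfun - Y))"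
    by (simp only: R_def bounded_bilinear.scaleR_left[OF bb] bounded_bilinear.scaleR_right[OF bb] scaleR_scaleR)
  also have "(id_blinfun - Y) o\<^sub>L (id_blinfun - Y) = id_blinfun - X"
    by (simp add: compose_simps YY)
  also have "(c * c) *\<^sub>R (id_blinfun - X) = (c * c * t) *\<^sub>R P"
    by (simp add: X_def)
  also have "\<dots> = P"
    by (simp add: c(2))
  finally have "R o\<^sub>L R = P" .
  moreover have "positive_op R"
  proof -
    have "R \<in> bounded_ops"
      by (simp add: R_def bounded_ops_scaleR bounded_ops_diff Y)
    \<comment> \<open>The form of \<open>Y\<close> is real and at most
      \<open>(norm x)\<^sup>2\<close>, since \<open>norm Y \<le> q < 1\<close>.\<close>
    moreover have "cinner (R x) x \<in> \<real>\<^sub>\<ge>\<^sub>0" for x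
    proof -
      have "Re (cinner (Y x) x) \<le> norm (Y x) * norm x"
        using complex_Re_le_cmod norm_cinner_le order_trans by blast
      also have "\<dots> \<le> (norm Y * norm x) * norm x"
        by (simp add: mult_right_mono norm_blinfun)
      also have "\<dots> \<le> (1 * norm x) * norm x"
        using Y q by (intro mult_right_mono) auto
      finally have "Re (cinner (Y x) x) \<le> (norm x)\<^sup>2"
        by (simp add: power2_eq_square)
      then show ?thesis
        using c selfadjoint_op_real[OF Y_self, of x]
        by (simp add: R_def complex_nonneg_Reals_iff blinfun.scaleR_left blinfun.diff_left
            cinner_scaleR_left cinner.diff_left cinner_self)
    qed
    ultimately show ?thesis by (simp add: positive_op_def)
  qed
  ultimately show ?thesis by blast
qed

text \<open>Whichever root \<open>SOME\<close> selects, it is positive, hence self-adjoint, and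
  moving one factor across the scalar product gives the norm formula. Composing the root with the
  inverse of \<open>P\<close>, on either side, inverts it.\<close>

lemma
  fixes P :: "'a::complex_hilbert \<Rightarrow>\<^sub>L 'a"
  assumes P: "P \<in> bounded_ops" and real: "\<And>x. Im (cinner (P x) x) = 0"
    and lower: "\<And>x. (norm x)\<^sup>2 \<le> Re (cinner (P x) x)"
  shows op_sqrt_invertible: "op_invertible (op_sqrt P)"
    and norm_op_sqrt: "(norm (blinfun_apply (op_sqrt P) x))\<^sup>2 = Re (cinner (P x) x)"
proof -
  define R where "R = op_sqrt P"
  have R: "positive_op R" "R o\<^sub>L R = P"
    using someI_ex[OF positive_sqrt_exists[OF assms]] by (simp_all add: R_def op_sqrt_def)
  then have R_bounded: "R \<in> bounded_ops" and "\<And>x. Im (cinner (R x) x) = 0"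
    by (simp_all add: positive_op_def complex_nonneg_Reals_iff)
  then have self: "selfadjoint_op R"
    by (rule selfadjoint_op_if_real)
  have P_inv: "op_invertible P"
    by (rule op_invertible_if_bounded_below[OF P lower])
  have "op_invertible R"
  proof (rule op_invertible_if_left_right)
    show "op_inverse P o\<^sub>L R \<in> bounded_ops"
      by (intro bounded_ops_compose op_inverse_bounded_ops P_inv R_bounded)
    show "(op_inverse P o\<^sub>L R) o\<^sub>L R = id_blinfun"
      using is_op_inverse_op_inverse[OF P_inv] by (simp add: blinfun_compose_assoc R is_op_inverse_def)
    show "R o\<^sub>L (R o\<^sub>L op_inverse P) = id_blinfun"
      using is_op_inverse_op_inverse[OF P_inv]
      by (simp add: blinfun_compose_assoc[symmetric] R is_op_inverse_def)
  qed
  then show "op_invertible (op_sqrt P)" by (simp add: R_def)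
  have "complex_of_real ((norm (R x))\<^sup>2) = cinner (R (R x)) x"
    using self unfolding selfadjoint_op_def by (metis cinner_self)
  also have "R (R x) = P x"
    using R(2) by (metis blinfun_apply_blinfun_compose)
  finally show "(norm (op_sqrt P x))\<^sup>2 = Re (cinner (P x) x)"
    by (metis R_def Re_complex_of_real)
qed

section \<open>Growth of powers and the spectral radius\<close>

lemma op_power_0 [simp]: "op_power T 0 = id_blinfun"
  by (simp add: op_power_def)

lemma op_power_Suc: "op_power T (Suc n) = T o\<^sub>L op_power T n"
  by (simp add: op_power_def)

lemma op_power_Suc_apply: "blinfun_apply (op_power T (Suc n)) x = op_power T n (T x)"
  by (induction n) (simp_all add: op_power_Suc)

section \<open>Scalar operators, spectrum and resolvent\<close>

definition scalar_op :: "complex \<Rightarrow> 'a::complex_hilbert \<Rightarrow>\<^sub>L 'a" where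
  "scalar_op z = Blinfun (\<lambda>x. z *\<^sub>C x)"

lemma scalar_op_apply [simp]: "blinfun_apply (scalar_op z) x = z *\<^sub>C x"
  by (simp add: scalar_op_def bounded_linear_Blinfun_apply bounded_linear_scaleC)

lemma scalar_op_bounded_ops: "scalar_op z \<in> bounded_ops"
  by (simp add: bounded_ops_def scaleC_scaleC mult.commute)

lemma scaleC_one [simp]: "1 *\<^sub>C x = (x :: 'a::complex_hilbert)"
  using scaleC_of_real[of 1 x] by simp

lemma scaleC_zero_left [simp]: "0 *\<^sub>C x = (0 :: 'a::complex_hilbert)"
  using scaleC_of_real[of 0 x] by simp

lemma scaleC_diff_right: "a *\<^sub>C (x - y) = a *\<^sub>C x - a *\<^sub>C (y :: 'a::complex_hilbert)"
  by (rule linear_diff[OF bounded_linear.linear[OF bounded_linear_scaleC]])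

lemma scaleC_diff_left: "(a - b) *\<^sub>C x = a *\<^sub>C x - b *\<^sub>C (x :: 'a::complex_hilbert)"
  by (metis add_diff_cancel_right' diff_add_cancel scaleC_add_left)

lemma scaleC_minus_left: "(- a) *\<^sub>C x = - (a *\<^sub>C (x :: 'a::complex_hilbert))"
  using scaleC_diff_left[of 0 a x] by simp

lemma norm_scalar_op_compose_le: "norm (scalar_op z o\<^sub>L T) \<le> cmod z * norm T"
  by (rule norm_blinfun_bound) (simp_all add: norm_scaleC mult.assoc mult_left_mono norm_blinfun)

lemma op_invertible_scalar_op: "z \<noteq> 0 \<Longrightarrow> op_invertible (scalar_op z)"
  unfolding op_invertible_def is_op_inverse_def
  by (intro exI[of _ "scalar_op (1 / z)"]) (auto intro!: blinfun_eqI simp: scalar_op_bounded_ops scaleC_scaleC)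

lemma op_spectrum_iff: "z \<in> op_spectrum T \<longleftrightarrow> \<not> op_invertible (T - scalar_op z)"
  by (simp add: op_spectrum_def scalar_op_def)

text \<open>The operators \<open>id_blinfun - (scalar_op z o\<^sub>L T)\<close> and
  \<open>T - scalar_op (1 / z)\<close> differ by the invertible factor \<open>- z\<close>. Inverting
  \<open>z\<close> moves the exterior of the spectral disc to a disc around 0, where power series
  are available.\<close>

lemma op_invertible_iff_notin_spectrum:
  assumes "z \<noteq> 0"
  shows "op_invertible (id_blinfun - (scalar_op z o\<^sub>L T)) \<longleftrightarrow> 1 / z \<notin> op_spectrum T"
proof -
  have "id_blinfun - (scalar_op z o\<^sub>L T) = scalar_op (- z) o\<^sub>L (T - scalar_op (1 / z))"
    using assms
    by (intro blinfun_eqI)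
      (simp add: blinfun.diff_left scaleC_diff_right scaleC_scaleC scaleC_minus_left)
  moreover have "T - scalar_op (1 / z) = scalar_op (- 1 / z) o\<^sub>L (id_blinfun - (scalar_op z o\<^sub>L T))"
    using assms
    by (intro blinfun_eqI)
      (simp add: blinfun.diff_left scaleC_diff_right scaleC_scaleC scaleC_minus_left)
  ultimately show ?thesis
    using op_invertible_compose op_invertible_scalar_op assms unfolding op_spectrum_iff
    by (metis divide_eq_0_iff neg_equal_0_iff_equal one_neq_zero)
qed

text \<open>Beyond \<open>norm T\<close> the operator \<open>T\<close> divided by \<open>z\<close>
  has norm below 1. The bound makes the supremum in \<open>op_spectral_radius\<close> an actual
  upper bound.\<close>

lemma op_spectrum_bounded:
  fixes T :: "'a::complex_hilbert \<Rightarrow>\<^sub>L 'a"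
  assumes T: "T \<in> bounded_ops" and z: "z \<in> op_spectrum T"
  shows "cmod z \<le> norm T"
proof (rule ccontr)
  assume less: "\<not> cmod z \<le> norm T"
  then have "cmod z > 0"
    using norm_ge_zero[of T] by linarith
  then have "z \<noteq> 0" by auto
  have "norm (scalar_op (1 / z) o\<^sub>L T) \<le> cmod (1 / z) * norm T"
    by (rule norm_scalar_op_compose_le)
  also have "\<dots> < 1"
    using less \<open>cmod z > 0\<close> by (simp add: norm_divide)
  finally have "op_invertible (id_blinfun - (scalar_op (1 / z) o\<^sub>L T))"
    by (intro op_invertible_id_minus bounded_ops_compose scalar_op_bounded_ops T)
  then show False
    using op_invertible_iff_notin_spectrum[of "1 / z" T] \<open>z \<noteq> 0\<close> z by simp
qed

lemma op_spectral_radius_ge: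
  fixes T :: "'a::complex_hilbert \<Rightarrow>\<^sub>L 'a"
  assumes "T \<in> bounded_ops"
  shows "0 \<le> op_spectral_radius T" "z \<in> op_spectrum T \<Longrightarrow> cmod z \<le> op_spectral_radius T"
proof -
  have "bdd_above (insert 0 (cmod ` op_spectrum T))"
    using op_spectrum_bounded[OF assms] by (auto intro!: bdd_aboveI[of _ "norm T"])
  then show "0 \<le> op_spectral_radius T" "z \<in> op_spectrum T \<Longrightarrow> cmod z \<le> op_spectral_radius T"
    unfolding op_spectral_radius_def by (auto intro: cSup_upper)
qed

lemma resolvent_exists:
  fixes T :: "'a::complex_hilbert \<Rightarrow>\<^sub>L 'a"
  assumes T: "T \<in> bounded_ops" and z: "cmod z * op_spectral_radius T < 1"
  shows "op_invertible (id_blinfun - (scalar_op z o\<^sub>L T))"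
proof (cases "z = 0")
  case True
  then have "scalar_op z o\<^sub>L T = 0" by (intro blinfun_eqI) simp
  then show ?thesis by simp
next
  case False
  then have "op_spectral_radius T < cmod (1 / z)"
    using z by (simp add: norm_divide field_simps)
  then have "1 / z \<notin> op_spectrum T"
    using op_spectral_radius_ge(2)[OF T] by fastforce
  then show ?thesis
    using op_invertible_iff_notin_spectrum[OF False, of T] by simp
qed

text \<open>
  The coefficients \<open>\<langle>T\<^sup>n x, y\<rangle>\<close> of the holomorphic function \<open>\<langle>(1 - z T)\<^sup>-\<^sup>1 x, y\<rangle>\<close> are
  controlled by Cauchy's inequality, uniformly in \<open>x\<close> and \<open>y\<close>.
\<close>

lemma norm_op_power_le:
  fixes T :: "'a::complex_hilbert \<Rightarrow>\<^sub>L 'a"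
  assumes T: "T \<in> bounded_ops" and s: "0 < s" "s < \<rho>"
    and inv: "\<And>z. cmod z < \<rho> \<Longrightarrow> op_invertible (id_blinfun - (scalar_op z o\<^sub>L T))"
  shows "\<exists>B. \<forall>n. norm (op_power T n) \<le> B / s ^ n"
proof -
  define G where "G z = op_inverse (id_blinfun - (scalar_op z o\<^sub>L T))" for z
  have G_bounded: "G z \<in> bounded_ops" if "cmod z < \<rho>" for z
    using op_inverse_bounded_ops[OF inv[OF that]] by (simp add: G_def)
  have G_left: "G z x - z *\<^sub>C G z (T x) = x" if "cmod z < \<rho>" for z x
    using op_inverse_left[OF inv[OF that], of x]
    by (simp add: G_def[symmetric] blinfun.diff_left blinfun.diff_right bounded_opsD[OF G_bounded[OF that]])
  have G_right: "G z x - z *\<^sub>C T (G z x) = x" if "cmod z < \<rho>" for z x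
    using op_inverse_right[OF inv[OF that], of x] by (simp add: G_def[symmetric] blinfun.diff_left)
  \<comment> \<open>Resolvent identity, the source of both the continuity and the derivative of
    \<open>G\<close>.\<close>
  have resolvent: "G w x - G z x = (w - z) *\<^sub>C G w (T (G z x))" if z: "cmod z < \<rho>" and w: "cmod w < \<rho>" for w z x
  proof -
    have "G w x = G w (G z x) - z *\<^sub>C G w (T (G z x))"
      using arg_cong[OF G_right[OF z, of x], of "G w"]
      by (simp add: blinfun.diff_right bounded_opsD[OF G_bounded[OF w]])
    then show ?thesis
      using G_left[OF w, of "G z x"] by (simp add: scaleC_diff_left algebra_simps)
  qed
  have diff_le: "norm (G w - G z) \<le> cmod (w - z) * (norm (G w) * (norm T * norm (G z)))"
    if z: "cmod z < \<rho>" and w: "cmod w < \<rho>" for w z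
  proof (rule norm_blinfun_bound)
    fix x
    have "norm (G w (T (G z x))) \<le> norm (G w) * (norm T * (norm (G z) * norm x))"
      by (meson norm_blinfun mult_left_mono norm_ge_zero order_trans)
    then have "cmod (w - z) * norm (G w (T (G z x)))
        \<le> cmod (w - z) * (norm (G w) * (norm T * (norm (G z) * norm x)))"
      by (rule mult_left_mono) simp
    then show "norm ((G w - G z) x) \<le> cmod (w - z) * (norm (G w) * (norm T * norm (G z))) * norm x"
      by (simp add: blinfun.diff_left resolvent[OF z w] norm_scaleC mult.assoc)
  qed simp
  have near: "\<forall>\<^sub>F w in at z. cmod w < \<rho>" if "cmod z < \<rho>" for z
  proof -
    have "\<forall>\<^sub>F w in at z. w \<in> ball 0 \<rho>"
      using that by (intro eventually_at_in_open') auto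
    then show ?thesis by (rule eventually_mono) simp
  qed
  have G_cont: "G \<midarrow>z\<rightarrow> G z" if z: "cmod z < \<rho>" for z
  proof -
    define a where "a = norm T * norm (G z)"
    have "((\<lambda>w. cmod (w - z) * a) \<longlongrightarrow> cmod (z - z) * a) (at z)"
      by (intro tendsto_intros)
    then have lim: "((\<lambda>w. cmod (w - z) * a) \<longlongrightarrow> 0) (at z)"
      by simp
    then have "\<forall>\<^sub>F w in at z. cmod (w - z) * a < 1 / 2"
      by (rule order_tendstoD) simp
    then have "\<forall>\<^sub>F w in at z. norm (G w - G z) \<le> cmod (w - z) * a * (2 * norm (G z))"
      using near[OF z]
    proof eventually_elim
      case (elim w)
      \<comment> \<open>The bound still involves \<open>norm (G w)\<close>. Near \<open>z\<close>
        its coefficient is below 1/2, so this norm can be absorbed and is at most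
        \<open>2 * norm (G z)\<close>.\<close>
      have d: "norm (G w - G z) \<le> cmod (w - z) * a * norm (G w)"
        using diff_le[OF z elim(2)] by (simp add: a_def mult_ac)
      also have "\<dots> \<le> 1 / 2 * norm (G w)"
        using elim(1) by (intro mult_right_mono) auto
      finally have "norm (G w) \<le> 2 * norm (G z)"
        using norm_triangle_ineq2[of "G w" "G z"] by linarith
      then have "cmod (w - z) * a * norm (G w) \<le> cmod (w - z) * a * (2 * norm (G z))"
        by (intro mult_left_mono) (simp_all add: a_def)
      with d show ?case by linarith
    qed
    moreover have "((\<lambda>w. cmod (w - z) * a * (2 * norm (G z))) \<longlongrightarrow> 0) (at z)"
      using tendsto_mult_left_zero[OF lim] by simp
    ultimately have "((\<lambda>w. G w - G z) \<longlongrightarrow> 0) (at z)"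
      by (rule Lim_null_comparison)
    then show ?thesis by (rule LIM_zero_cancel)
  qed
  \<comment> \<open>Compactness of the closed disc bounds the operator norm of \<open>G\<close>;
    this is what makes the later estimate uniform in \<open>x\<close> and \<open>y\<close>.\<close>
  have "continuous_on (cball 0 s) G"
    using G_cont s by (intro continuous_at_imp_continuous_on) (auto simp: isCont_def)
  then have "bounded (G ` cball 0 s)"
    using compact_continuous_image compact_imp_bounded compact_cball by blast
  then obtain B where B: "\<And>z. cmod z \<le> s \<Longrightarrow> norm (G z) \<le> B"
    unfolding bounded_iff by (metis imageI mem_cball_0)
  have B0: "B \<ge> 0"
    using B[of 0] s norm_ge_zero[of "G 0"] by (simp del: norm_ge_zero)
  have deriv: "((\<lambda>z. cinner (G z x) y) has_field_derivative cinner (G z (T (G z x))) y) (at z)"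
    if z: "cmod z < \<rho>" for x y z
    unfolding has_field_derivative_iff
  proof (rule Lim_transform_eventually)
    show "((\<lambda>w. cinner (G w (T (G z x))) y) \<longlongrightarrow> cinner (G z (T (G z x))) y) (at z)"
      by (intro cinner.tendsto blinfun.tendsto G_cont z tendsto_const)
    show "\<forall>\<^sub>F w in at z. cinner (G w (T (G z x))) y = (cinner (G w x) y - cinner (G z x) y) / (w - z)"
      using near[OF z] eventually_neq_at_within[of z]
    proof eventually_elim
      case (elim w)
      then show ?case
        by (simp add: cinner.diff_left[symmetric] resolvent[OF z] cinner_scaleC_left)
    qed
  qed
  have holo: "(\<lambda>z. cinner (G z x) y) holomorphic_on ball 0 \<rho>" for x y
    unfolding holomorphic_on_open[OF open_ball] using deriv by (meson mem_ball_0)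
  define F where "F x y = fps_expansion (\<lambda>z. cinner (G z x) y) 0" for x y
  have F: "(\<lambda>z. cinner (G z x) y) has_fps_expansion F x y" for x y
    unfolding F_def by (rule has_fps_expansion_fps_expansion[OF open_ball _ holo]) (use s in auto)
  \<comment> \<open>Taylor coefficients are found from
    \<open>G z x = x + z *\<^sub>C G z (T x)\<close>: each shift of the series replaces
    \<open>x\<close> by \<open>T x\<close>.\<close>
  have F_rec: "F x y = fps_const (cinner x y) + fps_X * F (T x) y" for x y
  proof (rule fps_expansion_unique_complex[OF F])
    have "(\<lambda>z. cinner x y + z * cinner (G z (T x)) y) has_fps_expansion
        fps_const (cinner x y) + fps_X * F (T x) y"
      by (intro has_fps_expansion_add has_fps_expansion_mult has_fps_expansion_const
          has_fps_expansion_fps_X F)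
    moreover have "\<forall>\<^sub>F z in nhds 0. cinner x y + z * cinner (G z (T x)) y = cinner (G z x) y"
    proof -
      have "\<forall>\<^sub>F z in nhds 0. z \<in> ball (0::complex) \<rho>"
        using s by (intro eventually_nhds_in_open) auto
      then show ?thesis
      proof eventually_elim
        case (elim z)
        then have "G z x = x + z *\<^sub>C G z (T x)"
          using G_left[of z x] by (simp add: algebra_simps)
        then show ?case
          by (simp add: cinner_add_left cinner_scaleC_left)
      qed
    qed
    ultimately show "(\<lambda>z. cinner (G z x) y) has_fps_expansion
        fps_const (cinner x y) + fps_X * F (T x) y"
      by (rule iffD1[OF has_fps_expansion_cong[OF _ refl], rotated])
  qed
  have F_nth: "fps_nth (F x y) n = cinner (op_power T n x) y" for x y n
  proof (induction n arbitrary: x)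
    case 0
    show ?case by (subst F_rec) simp
  next
    case (Suc n)
    show ?case by (subst F_rec) (simp add: Suc op_power_Suc_apply)
  qed
  have "norm (op_power T n) \<le> B / s ^ n" for n
  proof (rule norm_blinfun_bound)
    show "0 \<le> B / s ^ n" using B0 s by simp
    fix x
    \<comment> \<open>For this \<open>y\<close> the coefficient of index \<open>n\<close> is
      \<open>(norm y)\<^sup>2\<close>; one factor \<open>norm y\<close> cancels against Cauchy's
      inequality.\<close>
    define y where "y = op_power T n x"
    have "cmod ((deriv ^^ n) (\<lambda>z. cinner (G z x) y) 0) \<le> fact n * (B * norm x * norm y) / s ^ n"
    proof (rule Cauchy_inequality)
      show "(\<lambda>z. cinner (G z x) y) holomorphic_on ball 0 s"
        using s by (intro holomorphic_on_subset[OF holo]) auto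
      show "continuous_on (cball 0 s) (\<lambda>z. cinner (G z x) y)"
        using s by (intro continuous_on_subset[OF holomorphic_on_imp_continuous_on[OF holo]]) auto
      show "cmod (cinner (G z x) y) \<le> B * norm x * norm y" if "cmod (0 - z) = s" for z
      proof -
        have "cmod (cinner (G z x) y) \<le> norm (G z x) * norm y"
          by (rule norm_cinner_le)
        also have "\<dots> \<le> norm (G z) * norm x * norm y"
          by (intro mult_right_mono norm_blinfun) simp
        also have "\<dots> \<le> B * norm x * norm y"
          using B[of z] that by (intro mult_right_mono) auto
        finally show ?thesis .
      qed
    qed (rule s)
    also have "(deriv ^^ n) (\<lambda>z. cinner (G z x) y) 0 = fact n * cinner y y"
      using fps_nth_fps_expansion[OF F, of x y n] by (simp add: F_nth y_def)
    finally have "fact n * (norm y)\<^sup>2 \<le> fact n * (B * norm x * norm y / s ^ n)"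
      by (simp add: cinner_self norm_mult norm_power)
    then have "(norm y)\<^sup>2 \<le> B * norm x * norm y / s ^ n"
      by (rule mult_left_le_imp_le) simp
    then show "norm (op_power T n x) \<le> B / s ^ n * norm x"
      by (cases "y = 0") (use B0 s in \<open>simp_all add: y_def power2_eq_square field_simps\<close>)
  qed
  then show ?thesis by blast
qed

text \<open>The index 0 is left out because \<open>1 / real 0 = 0\<close>, so the denominator could
  vanish there.\<close>

lemma d_coeff_pos: "T \<in> bounded_ops \<Longrightarrow> 1 \<le> m \<Longrightarrow> 0 < d_coeff T m"
  using op_spectral_radius_ge(1)[of T] by (simp add: d_coeff_def add_pos_nonneg)

text \<open>The term \<open>1 / m\<close> leaves room for a radius \<open>s > d\<close> inside the
  disc where the resolvent exists; the powers grow at most like \<open>1 / s ^ n\<close>, and a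
  geometric series of ratio \<open>d\<^sup>2 / s\<^sup>2\<close> dominates.\<close>

lemma summable_d_coeff_norm_op_power:
  fixes T :: "'a::complex_hilbert \<Rightarrow>\<^sub>L 'a"
  assumes T: "T \<in> bounded_ops" and m: "1 \<le> m"
  shows "summable (\<lambda>n. d_coeff T m ^ (2 * n) * (norm (op_power T n))\<^sup>2)"
proof -
  define r where "r = op_spectral_radius T"
  define d where "d = d_coeff T m"
  \<comment> \<open>Shrinking \<open>1 / m\<close> to a half and to a third yields
    \<open>d < s < \<rho>\<close> while \<open>\<rho> * r < 1\<close> still holds, also when
    \<open>r = 0\<close>.\<close>
  define s where "s = 1 / (1 / (2 * real m) + r)"
  define \<rho> where "\<rho> = 1 / (1 / (3 * real m) + r)"
  have r: "r \<ge> 0"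
    using op_spectral_radius_ge(1)[OF T] by (simp add: r_def)
  have pos: "0 < 1 / (3 * real m) + r" "0 < 1 / (2 * real m) + r"
    using m r by (auto intro!: add_pos_nonneg)
  have frac: "1 / (3 * real m) < 1 / (2 * real m)" "1 / (2 * real m) < 1 / real m"
    using m by (simp_all add: field_simps)
  have d_pos: "d > 0"
    using d_coeff_pos[OF T m] by (simp add: d_def)
  have s: "0 < s" "s < \<rho>" "d < s"
    using pos frac by (auto simp: s_def \<rho>_def d_def d_coeff_def r_def[symmetric] intro!: divide_strict_left_mono mult_pos_pos)
  have "op_invertible (id_blinfun - (scalar_op z o\<^sub>L T))" if "cmod z < \<rho>" for z
  proof (rule resolvent_exists[OF T])
    have "cmod z * r \<le> \<rho> * r"
      using that r by (intro mult_right_mono) auto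
    also have "\<dots> < 1"
      using pos(1) m by (simp add: \<rho>_def divide_less_eq)
    finally show "cmod z * op_spectral_radius T < 1"
      by (simp add: r_def)
  qed
  then obtain B where B: "\<And>n. norm (op_power T n) \<le> B / s ^ n"
    using norm_op_power_le[OF T s(1,2)] by blast
  have "d\<^sup>2 < s\<^sup>2"
    using s d_pos by (intro power_strict_mono) auto
  then have "summable (\<lambda>n. B\<^sup>2 * (d\<^sup>2 / s\<^sup>2) ^ n)"
    using s by (intro summable_mult summable_geometric) simp
  then show ?thesis
  proof (rule summable_comparison_test')
    fix n :: nat
    have "(norm (op_power T n))\<^sup>2 \<le> (B / s ^ n)\<^sup>2"
      by (intro power_mono B) simp
    then have "d ^ (2 * n) * (norm (op_power T n))\<^sup>2 \<le> d ^ (2 * n) * (B / s ^ n)\<^sup>2"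
      using d_pos by (intro mult_left_mono) auto
    also have "\<dots> = B\<^sup>2 * (d\<^sup>2 / s\<^sup>2) ^ n"
      by (simp add: power_divide power_mult[symmetric] mult.commute)
    finally show "norm (d_coeff T m ^ (2 * n) * (norm (op_power T n))\<^sup>2) \<le> B\<^sup>2 * (d\<^sup>2 / s\<^sup>2) ^ n"
      using d_pos by (simp add: d_def[symmetric])
  qed
qed

section \<open>The operators \<open>R\<^sub>m\<close>\<close>

lemma cinner_op_power_adjoint:
  assumes "T \<in> bounded_ops"
  shows "cinner (blinfun_apply (op_power T n) x) y = cinner x (op_power (op_adjoint T) n y)"
proof (induction n arbitrary: x y)
  case (Suc n)
  have "cinner (op_power T (Suc n) x) y = cinner (op_power T n x) (op_adjoint T y)"
    by (simp add: op_power_Suc cinner_op_adjoint[OF assms])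
  also have "\<dots> = cinner x (op_power (op_adjoint T) (Suc n) y)"
    by (simp add: Suc op_power_Suc_apply)
  finally show ?case .
qed simp

text \<open>The square root results are applied to the sum \<open>P\<close> of the series, whose
  quadratic form is computed term by term from the adjoint relation.\<close>

lemma
  fixes T :: "'a::complex_hilbert \<Rightarrow>\<^sub>L 'a"
  assumes T: "T \<in> bounded_ops" and m: "1 \<le> m"
  shows R_op_invertible: "op_invertible (R_op T m)"
    and norm_R_op: "(\<lambda>n. d_coeff T m ^ (2 * n) * (norm (op_power T n x))\<^sup>2) sums
      (norm (R_op T m x))\<^sup>2"
proof -
  define d where "d = d_coeff T m"
  define Q where "Q n = d ^ (2 * n) *\<^sub>R (op_power (op_adjoint T) n o\<^sub>L op_power T n)" for n
  define P where "P = (\<Sum>n. Q n)"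
  have d: "d \<ge> 0" using d_coeff_pos[OF T m] by (simp add: d_def)
  have "summable Q"
  proof (rule summable_comparison_test'[OF summable_d_coeff_norm_op_power[OF T m]])
    fix n :: nat
    have "norm (op_power (op_adjoint T) n o\<^sub>L op_power T n)
        \<le> norm (op_power (op_adjoint T) n) * norm (op_power T n)"
      by (rule norm_blinfun_compose)
    also have "\<dots> \<le> norm (op_power T n) * norm (op_power T n)"
      by (intro mult_right_mono norm_blinfun_bound norm_adjoint_apply_le cinner_op_power_adjoint T)
        simp_all
    finally show "norm (Q n) \<le> d_coeff T m ^ (2 * n) * (norm (op_power T n))\<^sup>2"
      using d by (simp add: Q_def d_def[symmetric] power2_eq_square mult_left_mono)
  qed
  then have Q: "Q sums P"
    unfolding P_def by (rule summable_sums)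
  have Q_bounded: "Q n \<in> bounded_ops" for n
    by (simp add: Q_def bounded_ops_scaleR bounded_ops_compose bounded_ops_op_power
        op_adjoint_bounded_ops T)
  have "(\<Sum>k<n. Q k) \<in> bounded_ops" for n
    by (induction n) (simp_all add: bounded_ops_add Q_bounded)
  then have P_bounded: "P \<in> bounded_ops"
    using closed_sequentially[OF closed_bounded_ops, of "\<lambda>n. \<Sum>k<n. Q k"] Q by (simp add: sums_def)
  have form: "cinner (Q n x) x = of_real (d ^ (2 * n) * (norm (op_power T n x))\<^sup>2)" for n x
  proof -
    have "cinner (op_power (op_adjoint T) n (op_power T n x)) x
        = cnj (cinner x (op_power (op_adjoint T) n (op_power T n x)))"
      by (rule cinner_commute)
    also have "\<dots> = of_real ((norm (op_power T n x))\<^sup>2)"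
      by (simp only: cinner_op_power_adjoint[OF T, symmetric] cinner_self complex_cnj_complex_of_real)
    finally show ?thesis
      by (simp add: Q_def blinfun.scaleR_left cinner_scaleR_left scaleR_conv_of_real)
  qed
  have sums: "(\<lambda>n. complex_of_real (d ^ (2 * n) * (norm (op_power T n x))\<^sup>2)) sums cinner (P x) x" for x
    using bounded_linear.sums[OF bounded_linear_compose[OF cinner.bounded_linear_left[of x]
        blinfun.bounded_linear_left[of x]] Q]
    by (simp only: form)
  have Im: "Im (cinner (P x) x) = 0" for x
    using sums_Im[OF sums[of x]] sums_unique2[OF sums_zero] by simp
  have Re: "(\<lambda>n. d ^ (2 * n) * (norm (op_power T n x))\<^sup>2) sums Re (cinner (P x) x)" for x
    using sums_Re[OF sums[of x]] by simp
  \<comment> \<open>All terms are nonnegative, and the term of index 0 is already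
    \<open>(norm x)\<^sup>2\<close>.\<close>
  have lower: "(norm x)\<^sup>2 \<le> Re (cinner (P x) x)" for x
    using sum_le_suminf[OF sums_summable[OF Re[of x]], of "{0}"] sums_unique[OF Re[of x]] d
    by simp
  have "R_op T m = op_sqrt P"
    by (simp add: R_op_def P_def Q_def d_def)
  then show "op_invertible (R_op T m)"
    "(\<lambda>n. d_coeff T m ^ (2 * n) * (norm (op_power T n x))\<^sup>2) sums (norm (R_op T m x))\<^sup>2"
    using op_sqrt_invertible[OF P_bounded Im lower] norm_op_sqrt[OF P_bounded Im lower, of x] Re[of x]
    by (simp_all add: d_def)
qed

section \<open>Similar operators\<close>

lemma intertwine_op_power:
  assumes "A o\<^sub>L T = C o\<^sub>L A"
  shows "A o\<^sub>L op_power T n = op_power C n o\<^sub>L A"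
proof (induction n)
  case (Suc n)
  then show ?case
    by (simp only: op_power_Suc) (metis assms blinfun_compose_assoc)
qed simp

text \<open>Makes similarity symmetric, so that each one-sided estimate or inclusion can be reused
  with \<open>T\<close> and \<open>C\<close> exchanged.\<close>

lemma intertwine_inverse:
  assumes "op_invertible A" "A o\<^sub>L T = C o\<^sub>L A"
  shows "op_inverse A o\<^sub>L C = T o\<^sub>L op_inverse A"
  using is_op_inverse_op_inverse[OF assms(1)] assms(2) unfolding is_op_inverse_def
  by (metis blinfun_compose_assoc blinfun_compose_id)

text \<open>Complex linearity of \<open>A\<close> lets it commute with scalars, so
  \<open>C - scalar_op z\<close> is the conjugate of \<open>T - scalar_op z\<close> by
  \<open>A\<close>.\<close>

lemma op_spectrum_similar_subset:
  assumes A: "A \<in> bounded_ops" "op_invertible A" and similar: "A o\<^sub>L T = C o\<^sub>L A"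
  shows "op_spectrum C \<subseteq> op_spectrum T"
proof
  fix z assume z: "z \<in> op_spectrum C"
  have "C - scalar_op z = A o\<^sub>L (T - scalar_op z) o\<^sub>L op_inverse A"
  proof (rule blinfun_eqI)
    fix x
    have "A (T (op_inverse A x)) = C (A (op_inverse A x))"
      using similar by (metis blinfun_apply_blinfun_compose)
    then show "(C - scalar_op z) x = (A o\<^sub>L (T - scalar_op z) o\<^sub>L op_inverse A) x"
      by (simp add: blinfun.diff_left blinfun.diff_right bounded_opsD[OF A(1)] op_inverse_right[OF A(2)])
  qed
  then show "z \<in> op_spectrum T"
    using z op_invertible_compose op_invertible_op_inverse(1)[OF A(2,1)] A(2)
    unfolding op_spectrum_iff by metis
qed

lemma d_coeff_similar:
  assumes A: "A \<in> bounded_ops" "op_invertible A" and similar: "A o\<^sub>L T = C o\<^sub>L A"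
  shows "d_coeff C m = d_coeff T m"
proof -
  have "op_spectrum T \<subseteq> op_spectrum C"
    by (rule op_spectrum_similar_subset[OF op_inverse_bounded_ops[OF A(2)]
          op_invertible_op_inverse(1)[OF A(2,1)] intertwine_inverse[OF A(2) similar]])
  then have "op_spectrum C = op_spectrum T"
    using op_spectrum_similar_subset[OF assms] by blast
  then show ?thesis by (simp add: d_coeff_def op_spectral_radius_def)
qed

lemma norm_op_power_intertwine_le:
  assumes "A o\<^sub>L T = C o\<^sub>L A"
  shows "norm (blinfun_apply (op_power C n) (A x)) \<le> norm A * norm (op_power T n x)"
  using norm_blinfun[of A "op_power T n x"] intertwine_op_power[OF assms, of n]
  by (metis blinfun_apply_blinfun_compose)

text \<open>The series for the two squared norms have equal weights by
  \<open>d_coeff_similar\<close> and are compared term by term; the constant is independent of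
  \<open>m\<close>.\<close>

lemma norm_R_op_intertwine_le:
  fixes T A C :: "'a::complex_hilbert \<Rightarrow>\<^sub>L 'a"
  assumes "T \<in> bounded_ops" "C \<in> bounded_ops" "A \<in> bounded_ops" "op_invertible A"
    and similar: "A o\<^sub>L T = C o\<^sub>L A" and m: "1 \<le> m"
  shows "norm (R_op C m (A x)) \<le> norm A * norm (R_op T m x)"
proof (rule power2_le_imp_le)
  have d: "d_coeff C m = d_coeff T m"
    using assms by (intro d_coeff_similar)
  have "(norm (R_op C m (A x)))\<^sup>2 \<le> (norm A)\<^sup>2 * (norm (R_op T m x))\<^sup>2"
  proof (rule sums_le)
    show "(\<lambda>n. d_coeff T m ^ (2 * n) * (norm (op_power C n (A x)))\<^sup>2) sums (norm (R_op C m (A x)))\<^sup>2"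
      using norm_R_op[OF assms(2) m, of "A x"] by (simp add: d)
    show "(\<lambda>n. (norm A)\<^sup>2 * (d_coeff T m ^ (2 * n) * (norm (op_power T n x))\<^sup>2)) sums
        ((norm A)\<^sup>2 * (norm (R_op T m x))\<^sup>2)"
      by (intro sums_mult norm_R_op assms m)
    show "d_coeff T m ^ (2 * n) * (norm (op_power C n (A x)))\<^sup>2
        \<le> (norm A)\<^sup>2 * (d_coeff T m ^ (2 * n) * (norm (op_power T n x))\<^sup>2)" for n
    proof -
      have "(norm (op_power C n (A x)))\<^sup>2 \<le> (norm A * norm (op_power T n x))\<^sup>2"
        by (intro power_mono norm_op_power_intertwine_le similar) simp
      then have "d_coeff T m ^ (2 * n) * (norm (op_power C n (A x)))\<^sup>2
          \<le> d_coeff T m ^ (2 * n) * (norm A * norm (op_power T n x))\<^sup>2"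
        using d_coeff_pos[OF assms(1) m] by (intro mult_left_mono) auto
      then show ?thesis by (simp add: power_mult_distrib mult_ac)
    qed
  qed
  then show "(norm (R_op C m (A x)))\<^sup>2 \<le> (norm A * norm (R_op T m x))\<^sup>2"
    by (simp add: power_mult_distrib)
qed simp

section \<open>Conjugation of the two algebras\<close>

lemma deddens_algebra_conjugate:
  fixes T A C S :: "'a::complex_hilbert \<Rightarrow>\<^sub>L 'a"
  assumes A: "A \<in> bounded_ops" "op_invertible A" and similar: "A o\<^sub>L T = C o\<^sub>L A"
    and S: "S \<in> deddens_algebra T"
  shows "A o\<^sub>L S o\<^sub>L op_inverse A \<in> deddens_algebra C"
proof -
  obtain M where S_bounded: "S \<in> bounded_ops" and "M > 0"
    and M: "\<And>n x. norm (op_power T n (S x)) \<le> M * norm (op_power T n x)"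
    using S by (auto simp: deddens_algebra_def)
  \<comment> \<open>\<open>K\<close> is 0 on the zero space, whereas the definition asks for a
    positive constant; hence \<open>K + 1\<close> below.\<close>
  define K where "K = norm A * (M * norm (op_inverse A))"
  have "norm (op_power C n (A (S (op_inverse A x)))) \<le> (K + 1) * norm (op_power C n x)" for n x
  proof -
    have "norm (op_power C n (A (S (op_inverse A x)))) \<le> norm A * norm (op_power T n (S (op_inverse A x)))"
      by (rule norm_op_power_intertwine_le[OF similar])
    also have "\<dots> \<le> norm A * (M * norm (op_power T n (op_inverse A x)))"
      by (intro mult_left_mono M) simp
    also have "\<dots> \<le> norm A * (M * (norm (op_inverse A) * norm (op_power C n x)))"
      using \<open>M > 0\<close> norm_op_power_intertwine_le[OF intertwine_inverse[OF A(2) similar]]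
      by (intro mult_left_mono) auto
    also have "\<dots> = K * norm (op_power C n x)"
      by (simp add: K_def mult_ac)
    also have "\<dots> \<le> (K + 1) * norm (op_power C n x)"
      by (intro mult_right_mono) simp_all
    finally show ?thesis .
  qed
  moreover have "K + 1 > 0"
    using \<open>M > 0\<close> by (simp add: K_def add_nonneg_pos)
  ultimately show ?thesis
    unfolding deddens_algebra_def
    by (auto intro!: bounded_ops_compose A S_bounded op_inverse_bounded_ops)
qed

text \<open>Since \<open>R_op T m\<close> is onto, a bound \<open>K\<close> on the conjugated
  operator amounts to \<open>norm (R_op T m (S v)) \<le> K * norm (R_op T m v)\<close>. This has the
  shape of the Deddens condition, and the same chain of three estimates applies.\<close>

lemma spectral_radius_algebra_conjugate:
  fixes T A C S :: "'a::complex_hilbert \<Rightarrow>\<^sub>L 'a"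
  assumes T: "T \<in> bounded_ops" and C: "C \<in> bounded_ops"
    and A: "A \<in> bounded_ops" "op_invertible A" and similar: "A o\<^sub>L T = C o\<^sub>L A"
    and S: "S \<in> spectral_radius_algebra T"
  shows "A o\<^sub>L S o\<^sub>L op_inverse A \<in> spectral_radius_algebra C"
proof -
  obtain K where S_bounded: "S \<in> bounded_ops"
    and K: "\<And>m. 1 \<le> m \<Longrightarrow> norm (R_op T m o\<^sub>L S o\<^sub>L op_inverse (R_op T m)) \<le> K"
    using S by (auto simp: spectral_radius_algebra_def bdd_above_def)
  have K0: "K \<ge> 0"
    using K[of 1] norm_ge_zero order_trans by blast
  have "norm (R_op C m o\<^sub>L (A o\<^sub>L S o\<^sub>L op_inverse A) o\<^sub>L op_inverse (R_op C m))
      \<le> norm A * (K * norm (op_inverse A))" if m: "1 \<le> m" for m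
  proof (rule norm_blinfun_bound)
    show "0 \<le> norm A * (K * norm (op_inverse A))"
      using K0 by simp
    fix z
    \<comment> \<open>Chosen so that \<open>z\<close> is the image of \<open>w\<close> under
      \<open>R_op C m\<close>, and \<open>w\<close> is the image of \<open>v\<close> under
      \<open>A\<close>.\<close>
    define w where "w = op_inverse (R_op C m) z"
    define v where "v = op_inverse A w"
    have step: "norm (R_op T m (S v)) \<le> K * norm (R_op T m v)"
    proof -
      have "R_op T m (S v) = (R_op T m o\<^sub>L S o\<^sub>L op_inverse (R_op T m)) (R_op T m v)"
        by (simp add: op_inverse_left[OF R_op_invertible[OF T m]])
      then have "norm (R_op T m (S v))
          \<le> norm (R_op T m o\<^sub>L S o\<^sub>L op_inverse (R_op T m)) * norm (R_op T m v)"
        by (metis norm_blinfun)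
      also have "\<dots> \<le> K * norm (R_op T m v)"
        by (intro mult_right_mono K m) simp
      finally show ?thesis .
    qed
    have w: "R_op C m w = z"
      unfolding w_def by (rule op_inverse_right[OF R_op_invertible[OF C m]])
    have "norm (R_op C m (A (S v))) \<le> norm A * norm (R_op T m (S v))"
      by (rule norm_R_op_intertwine_le[OF T C A similar m])
    also have "\<dots> \<le> norm A * (K * norm (R_op T m v))"
      by (intro mult_left_mono step) simp
    also have "\<dots> \<le> norm A * (K * (norm (op_inverse A) * norm (R_op C m w)))"
      unfolding v_def using K0
      by (intro mult_left_mono norm_ge_zero norm_R_op_intertwine_le[OF C T op_inverse_bounded_ops[OF A(2)]
            op_invertible_op_inverse(1)[OF A(2,1)] intertwine_inverse[OF A(2) similar] m])
    finally show "norm ((R_op C m o\<^sub>L (A o\<^sub>L S o\<^sub>L op_inverse A) o\<^sub>L op_inverse (R_op C m)) z)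
        \<le> norm A * (K * norm (op_inverse A)) * norm z"
      by (simp add: v_def w w_def[symmetric] mult.assoc)
  qed
  then show ?thesis
    unfolding spectral_radius_algebra_def
    by (auto intro!: bounded_ops_compose A S_bounded op_inverse_bounded_ops bdd_aboveI)
qed

text \<open>Pure cancellation of \<open>A\<close> against its inverse, stated for arbitrary sets so
  that it serves both algebras.\<close>

lemma conjugate_sets:
  assumes A: "op_invertible A"
    and conj: "\<And>S. S \<in> D \<Longrightarrow> A o\<^sub>L S o\<^sub>L op_inverse A \<in> E"
    and conj_inv: "\<And>S. S \<in> E \<Longrightarrow> op_inverse A o\<^sub>L S o\<^sub>L A \<in> D"
  shows "op_left_mult A D = op_right_mult E A"
    and "op_right_mult (op_left_mult A D) (op_inverse A) = E"
    and "D = op_right_mult (op_left_mult (op_inverse A) E) A"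
proof -
  have inv: "op_inverse A o\<^sub>L A = id_blinfun" "A o\<^sub>L op_inverse A = id_blinfun"
    using is_op_inverse_op_inverse[OF A] by (simp_all add: is_op_inverse_def)
  have cancel: "A o\<^sub>L (op_inverse A o\<^sub>L S) = S" "op_inverse A o\<^sub>L (A o\<^sub>L S) = S" for S
    by (simp_all add: blinfun_compose_assoc[symmetric] inv)
  note simps = blinfun_compose_assoc inv cancel
  note conj = conj[unfolded blinfun_compose_assoc] and conj_inv = conj_inv[unfolded blinfun_compose_assoc]
  have left: "\<exists>S'. A o\<^sub>L S = S' o\<^sub>L A \<and> S' \<in> E" if "S \<in> D" for S
    using conj[OF that] by (intro exI[of _ "A o\<^sub>L (S o\<^sub>L op_inverse A)"]) (simp add: simps)
  have right: "\<exists>S'. S o\<^sub>L A = A o\<^sub>L S' \<and> S' \<in> D" if "S \<in> E" for S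
    using conj_inv[OF that] by (intro exI[of _ "op_inverse A o\<^sub>L (S o\<^sub>L A)"]) (simp add: simps)
  show eq: "op_left_mult A D = op_right_mult E A"
    using left right unfolding op_left_mult_def op_right_mult_def by fastforce
  show "op_right_mult (op_left_mult A D) (op_inverse A) = E"
    unfolding eq op_right_mult_def Setcompr_eq_image image_image by (simp add: simps)
  have "op_right_mult (op_left_mult (op_inverse A) E) A = op_left_mult (op_inverse A) (op_right_mult E A)"
    unfolding op_left_mult_def op_right_mult_def Setcompr_eq_image image_image by (simp add: simps)
  also have "\<dots> = D"
    unfolding eq[symmetric] op_left_mult_def Setcompr_eq_image image_image by (simp add: simps)
  finally show "D = op_right_mult (op_left_mult (op_inverse A) E) A" by simp
qed

theorem proposition2p1:
  fixes T A C :: "'a::complex_hilbert \<Rightarrow>\<^sub>L 'a"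
  assumes "T \<in> bounded_ops" and "A \<in> bounded_ops" and "C \<in> bounded_ops"
    and "op_invertible A"
    and "A o\<^sub>L T = C o\<^sub>L A"
  shows "(\<forall>n. A o\<^sub>L op_power T n = op_power C n o\<^sub>L A)
    \<and> op_left_mult A (deddens_algebra T) = op_right_mult (deddens_algebra C) A
    \<and> op_right_mult (op_left_mult A (deddens_algebra T)) (op_inverse A) = deddens_algebra C
    \<and> deddens_algebra T = op_right_mult (op_left_mult (op_inverse A) (deddens_algebra C)) A
    \<and> op_left_mult A (spectral_radius_algebra T) = op_right_mult (spectral_radius_algebra C) A
    \<and> op_right_mult (op_left_mult A (spectral_radius_algebra T)) (op_inverse A)
           = spectral_radius_algebra C
    \<and> spectral_radius_algebra T
           = op_right_mult (op_left_mult (op_inverse A) (spectral_radius_algebra C)) A"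
proof -
  note A = assms(2) assms(4)
  note similar = assms(5)
  \<comment> \<open>\<open>B\<close> plays the part of \<open>A\<close> for the pair
    \<open>C\<close>, \<open>T\<close>. As its inverse is \<open>A\<close>, conjugation by
    \<open>B\<close> undoes conjugation by \<open>A\<close>.\<close>
  define B where "B = op_inverse A"
  have B: "B \<in> bounded_ops" "op_invertible B" "op_inverse B = A" "B o\<^sub>L C = T o\<^sub>L B"
    using op_inverse_bounded_ops[OF A(2)] op_invertible_op_inverse[OF A(2,1)]
      intertwine_inverse[OF A(2) similar] by (simp_all add: B_def)
  have deddens_inv: "op_inverse A o\<^sub>L S o\<^sub>L A \<in> deddens_algebra T" if "S \<in> deddens_algebra C" for S
    using deddens_algebra_conjugate[OF B(1,2,4) that] by (simp add: B(3) B_def[symmetric])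
  have spectral_inv: "op_inverse A o\<^sub>L S o\<^sub>L A \<in> spectral_radius_algebra T"
    if "S \<in> spectral_radius_algebra C" for S
    using spectral_radius_algebra_conjugate[OF assms(3,1) B(1,2,4) that] by (simp add: B(3) B_def[symmetric])
  show ?thesis
    using intertwine_op_power[OF similar]
      conjugate_sets[OF A(2) deddens_algebra_conjugate[OF A similar] deddens_inv]
      conjugate_sets[OF A(2) spectral_radius_algebra_conjugate[OF assms(1,3) A similar] spectral_inv]
    by (intro conjI allI)
qed

end
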